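(* Let $M \geq 2$, let $\lambda \in \mathbb{C}$ with $|\lambda| = 1$, and let $J_\lambda$ be the $M\times M$ Jordan cell with eigenvalue $\lambda$. For each $1 \le m \le M$ let $\{\widetilde{y}_m(n) : n \ge 0\} \subset \mathbb{C}$ be a sequence, and suppose that: (i) for all $1 \le m \le M$, $y_m(n) = \dfrac{\widetilde{y}_m(n)}{n^{m-1}}$ for all $n \ge 1$; (ii) for each $m \in \{1,2,\ldots,M\}$ there exists some $\alpha_m \in \mathbb{C}$ such that the solution of the scalar difference equation $z_{n+1} = \lambda z_n + \widetilde{y}_m(n)$, $n \ge 1$, $z_1 = \alpha_m$, is bounded (equivalently, the sequence of sums $\left\{\sum_{n=1}^{N} \widetilde{y}_m(n)\lambda^{-n}\right\}_{N \ge 1}$ is bounded). Let $y(n) = (y_1(n),\ldots,y_M(n))^{T}$, let $x(1) = (x_1(1),\ldots,x_M(1))^{T} \in \mathbb{C}^M$, and let $\{x(n)\}_{n\ge 1} \subset \mathbb{C}^M$ be the solution of $$x(n+1) = J_\lambda x(n) + y(n), \quad n \ge 1,$$ with this initial value $x(1)$. Then $\{x(n)\}_{n \ge 1}$ is bounded if and only if for all $m \in \{2,\ldots,M\}$ $$x_m(1) = -\sum_{r=0}^{M-m} (-1)^r \sum_{k=1}^{\infty} \frac{(k)^{[r]}}{r!}\, \lambda^{-k-r}\, y_{r+m}(k).$$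
   Context: $J_\lambda$ is the upper triangular $M \times M$ matrix with $\lambda$ in every diagonal entry, $1$ in every entry directly above the diagonal, and $0$ elsewhere. The rising factorial is $(k)^{[r]} := \prod_{i=0}^{r-1}(k+i)$, with $(k)^{[0]} = 1$. Infinite series are understood as limits of partial sums (convergence need not be absolute). $\mathbb{C}^M$ carries the Euclidean norm. *)

theory Defs
  imports
    "HOL-Analysis.L2_Norm"
    "Jordan_Normal_Form.Jordan_Normal_Form"
begin

definition euclidean_norm_vec :: "complex vec \<Rightarrow> real" where
  "euclidean_norm_vec v = L2_set (\<lambda>i. cmod (v $ i)) {..<dim_vec v}"

text \<open>Vector sequences are indexed by the times n \<open>\<ge>\<close> 1; the value at time 0 is irrelevant.\<close>

definition bounded_vec_seq :: "(nat \<Rightarrow> complex vec) \<Rightarrow> bool" where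
  "bounded_vec_seq x \<longleftrightarrow> (\<exists>C. \<forall>n\<ge>1. euclidean_norm_vec (x n) \<le> C)"

text \<open>The bounded solution of the scalar equation with right-hand side \<open>w\<close>, for some initial
  value \<open>\<alpha>\<close>. A sequence \<open>z\<close> as below is determined by \<open>\<alpha>\<close> at all times n \<open>\<ge>\<close> 1.\<close>

definition has_bounded_scalar_solution :: "complex \<Rightarrow> (nat \<Rightarrow> complex) \<Rightarrow> bool" where
  "has_bounded_scalar_solution lam w \<longleftrightarrow>
     (\<exists>\<alpha>. \<exists>z :: nat \<Rightarrow> complex. z 1 = \<alpha> \<and> (\<forall>n\<ge>1. z (n + 1) = lam * z n + w n) \<and>
        (\<exists>C. \<forall>n\<ge>1. cmod (z n) \<le> C))"

text \<open>The k-th term of the series with parameters m and r; \<open>pochhammer\<close> is the rising factorial.\<close>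

definition init_series_term ::
    "complex \<Rightarrow> (nat \<Rightarrow> nat \<Rightarrow> complex) \<Rightarrow> nat \<Rightarrow> nat \<Rightarrow> nat \<Rightarrow> complex" where
  "init_series_term lam y m r k =
     pochhammer (of_nat k) r / fact r * lam powi (- int k - int r) * y (r + m) k"

end

theory Submission
  imports Defs
begin

text \<open>After the rescaling \<open>u m n = lam^-(m+n) * x\<^sub>m(n)\<close>, \<open>v m n = lam^-(m+n+1) * y\<^sub>m(n)\<close> the system reads
  \<open>u m (n+1) = u m n + u (m+1) n + v m n\<close>, and the coordinates of a bounded homogeneous solution
  vanish for \<open>m \<ge> 2\<close> and are constant for \<open>m = 1\<close>. So everything rests on one bounded particular
  solution. Cutting the forcing off at time \<open>K\<close> and solving backwards from zero gives the explicit
  solution with \<open>- (\<Sum>r. (-1)^r * (\<Sum>j=n..<K. ((j-n+r) choose r) * v (m+r) j))\<close> as \<open>m\<close>-th coordinate. Since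
  \<open>((j-n+r) choose r) / j^(m+r-1)\<close> is a product of monotone factors with values in \<open>[0,1]\<close>, repeated
  Abel summation bounds these sums uniformly in \<open>n\<close> and \<open>K\<close> for \<open>m \<ge> 1\<close>, and makes them converge as
  \<open>K \<rightarrow> \<infinity>\<close> for \<open>m \<ge> 2\<close>. For \<open>m = 1\<close> there is no limit, but summing the limit for \<open>m = 2\<close> over \<open>n\<close>
  telescopes to differences of the uniformly bounded truncated sums.\<close>

section \<open>Abel summation with monotone real factors\<close>

text \<open>Abel summation on a nonempty block. All inner sums of \<open>w\<close> start at the same
  \<open>p\<close>, so a bound on blocks of \<open>w\<close> applies to each of them
  directly.\<close>

lemma sum_scaleR_by_parts:
  fixes w :: "nat \<Rightarrow> 'a::real_vector"
  assumes "p \<le> q"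
  shows "(\<Sum>j\<in>{p..<Suc q}. f j *\<^sub>R w j) =
    f q *\<^sub>R sum w {p..<Suc q} - (\<Sum>j\<in>{p..<q}. (f (Suc j) - f j) *\<^sub>R sum w {p..<Suc j})"
  using assms
proof (induction q rule: dec_induct)
  case base
  show ?case by simp
next
  case (step q)
  then have "p \<le> Suc q" by simp
  then have *: "sum w {p..<Suc (Suc q)} = sum w {p..<Suc q} + w (Suc q)"
    by (rule sum.atLeastLessThan_Suc)
  have "(\<Sum>j\<in>{p..<Suc (Suc q)}. f j *\<^sub>R w j) = (\<Sum>j\<in>{p..<Suc q}. f j *\<^sub>R w j) + f (Suc q) *\<^sub>R w (Suc q)"
    using \<open>p \<le> Suc q\<close> by (rule sum.atLeastLessThan_Suc)
  also have "\<dots> = f (Suc q) *\<^sub>R (sum w {p..<Suc q} + w (Suc q))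
    - ((\<Sum>j\<in>{p..<q}. (f (Suc j) - f j) *\<^sub>R sum w {p..<Suc j}) + (f (Suc q) - f q) *\<^sub>R sum w {p..<Suc q})"
    unfolding step.IH by (simp add: algebra_simps)
  also have "(\<Sum>j\<in>{p..<q}. (f (Suc j) - f j) *\<^sub>R sum w {p..<Suc j}) + (f (Suc q) - f q) *\<^sub>R sum w {p..<Suc q}
    = (\<Sum>j\<in>{p..<Suc q}. (f (Suc j) - f j) *\<^sub>R sum w {p..<Suc j})"
    using step.hyps by (intro sum.atLeastLessThan_Suc [symmetric]) auto
  finally show ?case by (simp only: *)
qed

text \<open>A monotone factor with values in \<open>[0, A]\<close> has total variation at most
  \<open>A\<close>. The boundary term and the variation term of Abel summation therefore contribute
  at most \<open>A * B\<close> each. The conclusion again concerns arbitrary blocks beyond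
  \<open>N\<close>, so the estimate can be iterated factor by factor.\<close>

lemma norm_sum_monotone_scaleR_le:
  fixes w :: "nat \<Rightarrow> 'a::real_normed_vector"
  assumes mono: "mono_on {N..} f \<or> antimono_on {N..} f"
    and f: "\<And>j. N \<le> j \<Longrightarrow> 0 \<le> f j \<and> f j \<le> A"
    and w: "\<And>p q. N \<le> p \<Longrightarrow> norm (sum w {p..<q}) \<le> B"
    and "N \<le> p"
  shows "norm (\<Sum>j\<in>{p..<q}. f j *\<^sub>R w j) \<le> 2 * A * B"
proof -
  have "0 \<le> A" using f[of N] by auto
  have "0 \<le> B" using w[of p p] \<open>N \<le> p\<close> by simp
  show ?thesis
  proof (cases "p < q")
    case False
    then show ?thesis using \<open>0 \<le> A\<close> \<open>0 \<le> B\<close> by simp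
  next
    case True
    then obtain q' where q': "q = Suc q'" "p \<le> q'" by (metis less_Suc_eq_le less_imp_Suc_add le_add1 add_Suc_right)
    \<comment> \<open>All increments have the same sign, so the absolute value moves outside the
      sum, which then telescopes.\<close>
    have "(\<Sum>j\<in>{p..<q'}. \<bar>f (Suc j) - f j\<bar>) = \<bar>\<Sum>j\<in>{p..<q'}. (f (Suc j) - f j)\<bar>"
      using mono
    proof
      assume "mono_on {N..} f"
      then have "f j \<le> f (Suc j)" if "j \<in> {p..<q'}" for j
        using that \<open>N \<le> p\<close> by (auto simp: monotone_on_def)
      then show ?thesis
        using sum_nonneg[of "{p..<q'}" "\<lambda>j. f (Suc j) - f j"] by simp
    next
      assume "antimono_on {N..} f"
      then have *: "f (Suc j) \<le> f j" if "j \<in> {p..<q'}" for j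
        using that \<open>N \<le> p\<close> by (auto simp: monotone_on_def)
      then have "(\<Sum>j\<in>{p..<q'}. \<bar>f (Suc j) - f j\<bar>) = (\<Sum>j\<in>{p..<q'}. - (f (Suc j) - f j))"
        by (intro sum.cong) auto
      also have "\<dots> = - (\<Sum>j\<in>{p..<q'}. f (Suc j) - f j)" by (rule sum_negf)
      also have "\<dots> = \<bar>\<Sum>j\<in>{p..<q'}. (f (Suc j) - f j)\<bar>"
        using sum_nonpos[of "{p..<q'}" "\<lambda>j. f (Suc j) - f j"] * by simp
      finally show ?thesis .
    qed
    also have "(\<Sum>j\<in>{p..<q'}. (f (Suc j) - f j)) = f q' - f p"
      using q' by (simp add: sum_Suc_diff')
    also have "\<bar>f q' - f p\<bar> \<le> A" using f[of p] f[of q'] q' \<open>N \<le> p\<close> by auto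
    finally have var: "(\<Sum>j\<in>{p..<q'}. \<bar>f (Suc j) - f j\<bar>) \<le> A" .
    have "norm (\<Sum>j\<in>{p..<q}. f j *\<^sub>R w j) \<le> norm (f q' *\<^sub>R sum w {p..<Suc q'})
        + norm (\<Sum>j\<in>{p..<q'}. (f (Suc j) - f j) *\<^sub>R sum w {p..<Suc j})"
      unfolding q'(1) sum_scaleR_by_parts[OF q'(2)] by (rule norm_triangle_ineq4)
    also have "norm (f q' *\<^sub>R sum w {p..<Suc q'}) \<le> A * B"
      using f[of q'] q' \<open>N \<le> p\<close> \<open>0 \<le> A\<close> unfolding norm_scaleR
      by (intro mult_mono w) auto
    also have "norm (\<Sum>j\<in>{p..<q'}. (f (Suc j) - f j) *\<^sub>R sum w {p..<Suc j})
        \<le> (\<Sum>j\<in>{p..<q'}. \<bar>f (Suc j) - f j\<bar> * B)"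
      by (intro sum_norm_le) (simp only: norm_scaleR real_norm_def mult_left_mono w[OF \<open>N \<le> p\<close>] abs_ge_zero)
    also have "\<dots> \<le> A * B"
      using var \<open>0 \<le> B\<close> by (simp add: sum_distrib_right[symmetric] mult_right_mono)
    finally show ?thesis by simp
  qed
qed

section \<open>Binomially weighted tails and Pascal's rule\<close>

text \<open>This is the \<open>(r+1)\<close>-fold iterated tail sum of \<open>v\<close>, cut off at
  time \<open>K\<close>: one more summation over tails turns the weight
  \<open>(j - n + r) choose r\<close> into \<open>(j - n + r + 1) choose (r + 1)\<close>. The
  subtraction \<open>j - n\<close> is exact on the range of summation.\<close>

definition weighted_tail :: "nat \<Rightarrow> nat \<Rightarrow> nat \<Rightarrow> (nat \<Rightarrow> complex) \<Rightarrow> complex" where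
  "weighted_tail r K n v = (\<Sum>j\<in>{n..<K}. of_nat ((j - n + r) choose r) * v j)"

lemma weighted_tail_0:
  assumes "n < K"
  shows "weighted_tail 0 K n v = v n + weighted_tail 0 K (Suc n) v"
  using assms by (simp add: weighted_tail_def sum.atLeast_Suc_lessThan)

text \<open>Pascal's rule for each \<open>j > n\<close>. The term \<open>j = n\<close> is split off
  first: its weight is 1 in both tails that start at \<open>n\<close>, and it is absent from the
  tail that starts at \<open>Suc n\<close>.\<close>

lemma weighted_tail_Suc:
  assumes "n < K"
  shows "weighted_tail (Suc r) K n v = weighted_tail r K n v + weighted_tail (Suc r) K (Suc n) v"
proof -
  have "(\<Sum>j\<in>{Suc n..<K}. of_nat ((j - n + Suc r) choose Suc r) * v j) =
      (\<Sum>j\<in>{Suc n..<K}. of_nat ((j - n + r) choose r) * v j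
        + of_nat ((j - Suc n + Suc r) choose Suc r) * v j)"
  proof (rule sum.cong)
    fix j assume "j \<in> {Suc n..<K}"
    then obtain i where j: "j = Suc n + i" by (metis atLeastLessThan_iff le_Suc_ex)
    show "of_nat ((j - n + Suc r) choose Suc r) * v j = of_nat ((j - n + r) choose r) * v j
        + of_nat ((j - Suc n + Suc r) choose Suc r) * v j"
      by (simp add: j algebra_simps)
  qed simp
  then show ?thesis
    using assms unfolding weighted_tail_def
    by (simp only: sum.atLeast_Suc_lessThan sum.distrib) simp
qed

section \<open>Uniform bounds and convergence for weights of the form binomial over power\<close>

text \<open>The absorption identity for binomial coefficients peels off a single factor. For
  \<open>i = j - n\<close> this factor is monotone in \<open>j\<close>, which prepares the induction
  on \<open>r\<close>.\<close>

lemma binomial_Suc_div_power: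
  assumes "0 < (j::nat)"
  shows "real ((i + Suc r) choose Suc r) / real j ^ Suc r =
    (real (i + Suc r) / (real (Suc r) * real j)) * (real ((i + r) choose r) / real j ^ r)"
proof -
  have "real (Suc r) * real ((i + Suc r) choose Suc r) = real (i + Suc r) * real ((i + r) choose r)"
    using Suc_times_binomial_eq[of "i + r" r] by (simp only: add_Suc_right of_nat_mult[symmetric] mult.commute)
  then have "real ((i + Suc r) choose Suc r) = real (i + Suc r) * real ((i + r) choose r) / real (Suc r)"
    by (simp add: nonzero_eq_divide_eq mult.commute del: of_nat_Suc binomial_Suc_Suc)
  then show ?thesis using assms
    by (simp only: power_Suc times_divide_times_eq divide_divide_eq_left mult.assoc)
qed

text \<open>The weight is a product of \<open>r\<close> monotone factors with values in
  \<open>[0, 1]\<close>, and each costs a factor 2 by Abel summation. The resulting bound depends on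
  neither \<open>n\<close> nor the block.\<close>

lemma norm_binomial_weighted_sum_le:
  fixes w :: "nat \<Rightarrow> complex"
  assumes w: "\<And>p q. 1 \<le> p \<Longrightarrow> norm (sum w {p..<q}) \<le> B"
    and "1 \<le> n" "n \<le> p"
  shows "norm (\<Sum>j\<in>{p..<q}. (real ((j - n + r) choose r) / real j ^ r) *\<^sub>R w j) \<le> 2 ^ r * B"
  using \<open>n \<le> p\<close>
proof (induction r arbitrary: p q)
  case 0
  then show ?case using w[of p q] \<open>1 \<le> n\<close> by simp
next
  case (Suc r)
  define f where "f j = real (j - n + Suc r) / (real (Suc r) * real j)" for j
  \<comment> \<open>As a function of \<open>1 / j\<close> the factor is affine with slope
    \<open>(Suc r - n) / Suc r\<close>. The sign of the slope, which changes with \<open>n\<close>,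
    decides between decreasing and increasing.\<close>
  have f_eq: "f j = 1 / real (Suc r) + ((real (Suc r) - real n) / real (Suc r)) * (1 / real j)" if "n \<le> j" for j
  proof -
    have *: "real (j - n + Suc r) = real j + (real (Suc r) - real n)"
      using that by (simp add: of_nat_diff)
    show ?thesis
      unfolding f_def * add_divide_distrib using that \<open>1 \<le> n\<close> by simp
  qed
  have mono: "mono_on {n..} f \<or> antimono_on {n..} f"
  proof (cases "n \<le> Suc r")
    case True
    have "f j \<le> f i" if "n \<le> i" "i \<le> j" for i j
    proof -
      have "1 / real j \<le> 1 / real i" using that \<open>1 \<le> n\<close> by (intro divide_left_mono) auto
      then show ?thesis using that True
        by (simp only: f_eq f_eq[OF order_trans] add_le_cancel_left) (intro mult_left_mono, auto)
    qed
    then show ?thesis by (auto simp: monotone_on_def)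
  next
    case False
    have "f i \<le> f j" if "n \<le> i" "i \<le> j" for i j
    proof -
      have "1 / real j \<le> 1 / real i" using that \<open>1 \<le> n\<close> by (intro divide_left_mono) auto
      then show ?thesis using that False
        by (simp only: f_eq f_eq[OF order_trans] add_le_cancel_left)
          (intro mult_left_mono_neg, auto simp: divide_nonpos_pos)
    qed
    then show ?thesis by (auto simp: monotone_on_def)
  qed
  \<comment> \<open>Here \<open>1 \<le> n \<le> j\<close> gives
    \<open>j - n + r + 1 \<le> j + r \<le> (r + 1) * j\<close>.\<close>
  have bnd: "0 \<le> f j \<and> f j \<le> 1" if "n \<le> j" for j
  proof -
    have "j - n + Suc r \<le> j + r" using that \<open>1 \<le> n\<close> by simp
    also have "\<dots> \<le> Suc r * j" using that \<open>1 \<le> n\<close> by (cases j) auto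
    finally have "real (j - n + Suc r) \<le> real (Suc r) * real j"
      by (simp only: of_nat_mult[symmetric] of_nat_le_iff)
    moreover have "0 < real (Suc r) * real j" using that \<open>1 \<le> n\<close> by simp
    ultimately show ?thesis unfolding f_def by (simp del: of_nat_Suc)
  qed
  have "norm (\<Sum>j\<in>{p..<q}. f j *\<^sub>R ((real ((j - n + r) choose r) / real j ^ r) *\<^sub>R w j))
      \<le> 2 * 1 * (2 ^ r * B)"
    by (rule norm_sum_monotone_scaleR_le[OF mono bnd Suc.IH Suc.prems])
  also have "(\<Sum>j\<in>{p..<q}. f j *\<^sub>R ((real ((j - n + r) choose r) / real j ^ r) *\<^sub>R w j))
      = (\<Sum>j\<in>{p..<q}. (real ((j - n + Suc r) choose Suc r) / real j ^ Suc r) *\<^sub>R w j)"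
    using Suc.prems \<open>1 \<le> n\<close>
    by (intro sum.cong refl) (subst binomial_Suc_div_power, auto simp: f_def)
  finally show ?case by simp
qed

lemma antimono_on_inverse_nat: "1 \<le> n \<Longrightarrow> antimono_on {n..} (\<lambda>j. 1 / real j)"
  by (auto simp: monotone_on_def intro!: divide_left_mono)

text \<open>Every surplus power of \<open>1 / j\<close> is one more monotone factor with values in
  \<open>[0, 1]\<close>, hence one more factor 2.\<close>

lemma norm_binomial_weighted_sum_le':
  fixes w :: "nat \<Rightarrow> complex"
  assumes w: "\<And>p q. 1 \<le> p \<Longrightarrow> norm (sum w {p..<q}) \<le> B"
    and "1 \<le> n" "n \<le> p" "r \<le> s"
  shows "norm (\<Sum>j\<in>{p..<q}. (real ((j - n + r) choose r) / real j ^ s) *\<^sub>R w j) \<le> 2 ^ s * B"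
  using \<open>r \<le> s\<close> \<open>n \<le> p\<close>
proof (induction s arbitrary: p q rule: dec_induct)
  case base
  then show ?case using norm_binomial_weighted_sum_le[OF w \<open>1 \<le> n\<close>] by blast
next
  case (step s)
  have bnd: "0 \<le> 1 / real j \<and> 1 / real j \<le> 1" if "n \<le> j" for j
    using that \<open>1 \<le> n\<close> by simp
  have "norm (\<Sum>j\<in>{p..<q}. (1 / real j) *\<^sub>R ((real ((j - n + r) choose r) / real j ^ s) *\<^sub>R w j))
      \<le> 2 * 1 * (2 ^ s * B)"
    by (rule norm_sum_monotone_scaleR_le[OF disjI2[OF antimono_on_inverse_nat[OF \<open>1 \<le> n\<close>]] bnd step.IH step.prems])
  then show ?case by simp
qed

text \<open>The strict inequality \<open>r < s\<close> leaves one spare factor \<open>1 / j\<close>.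
  Beyond \<open>p\<close> it is at most \<open>1 / p\<close>, so blocks starting at \<open>p\<close>
  are of size \<open>O(1 / p)\<close> and the Cauchy criterion applies. Absolute convergence is not
  claimed.\<close>

lemma summable_binomial_weighted:
  fixes w :: "nat \<Rightarrow> complex"
  assumes w: "\<And>p q. 1 \<le> p \<Longrightarrow> norm (sum w {p..<q}) \<le> B"
    and "1 \<le> n" "r < s"
  shows "summable (\<lambda>j. (real ((j - n + r) choose r) / real j ^ s) *\<^sub>R w j)"
proof -
  obtain s' where s': "s = Suc s'" "r \<le> s'" using \<open>r < s\<close> by (cases s) auto
  have tail: "norm (\<Sum>j\<in>{p..<q}. (real ((j - n + r) choose r) / real j ^ s) *\<^sub>R w j)
      \<le> 2 * (1 / real p) * (2 ^ s' * B)" if "n \<le> p" for p q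
  proof -
    have "norm (\<Sum>j\<in>{p..<q}. (1 / real j) *\<^sub>R ((real ((j - n + r) choose r) / real j ^ s') *\<^sub>R w j))
      \<le> 2 * (1 / real p) * (2 ^ s' * B)"
    proof (rule norm_sum_monotone_scaleR_le[where N = p])
      show "mono_on {p..} (\<lambda>j. 1 / real j) \<or> antimono_on {p..} (\<lambda>j. 1 / real j)"
        using antimono_on_inverse_nat[of p] that \<open>1 \<le> n\<close> by simp
      show "0 \<le> 1 / real j \<and> 1 / real j \<le> 1 / real p" if "p \<le> j" for j
        using that \<open>n \<le> p\<close> \<open>1 \<le> n\<close> by (auto intro!: divide_left_mono)
      show "norm (\<Sum>j\<in>{p'..<q'}. (real ((j - n + r) choose r) / real j ^ s') *\<^sub>R w j) \<le> 2 ^ s' * B"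
        if "p \<le> p'" for p' q'
        using norm_binomial_weighted_sum_le'[OF w \<open>1 \<le> n\<close> _ s'(2)] that \<open>n \<le> p\<close> by simp
    qed simp
    then show ?thesis by (simp add: s'(1))
  qed
  have "(\<lambda>p. 2 * (1 / real p) * (2 ^ s' * B)) \<longlonglongrightarrow> 2 * 0 * (2 ^ s' * B)"
    by (intro tendsto_intros lim_1_over_n)
  then have lim: "(\<lambda>p. 2 * (1 / real p) * (2 ^ s' * B)) \<longlonglongrightarrow> 0" by simp
  show ?thesis
    unfolding summable_Cauchy
  proof (intro allI impI)
    fix e :: real assume "0 < e"
    then have "\<forall>\<^sub>F p in sequentially. 2 * (1 / real p) * (2 ^ s' * B) < e"
      using order_tendstoD(2)[OF lim] by simp
    then obtain P where P: "\<And>p. P \<le> p \<Longrightarrow> 2 * (1 / real p) * (2 ^ s' * B) < e"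
      by (auto simp: eventually_sequentially)
    show "\<exists>N. \<forall>m\<ge>N. \<forall>q. norm (\<Sum>j\<in>{m..<q}. (real ((j - n + r) choose r) / real j ^ s) *\<^sub>R w j) < e"
    proof (intro exI allI impI)
      fix p q assume "max n P \<le> p"
      then show "norm (\<Sum>j\<in>{p..<q}. (real ((j - n + r) choose r) / real j ^ s) *\<^sub>R w j) < e"
        using tail[of p q] P[of p] by simp
    qed
  qed
qed


section \<open>A bounded particular solution of the rescaled system\<close>

text \<open>The range \<open>r < M\<close> is the same for every \<open>m\<close>, so that
  coordinates \<open>m\<close> and \<open>Suc m\<close> can be compared term by term. For forcing
  that vanishes in coordinates above \<open>M\<close>, the terms with \<open>m + r > M\<close> are
  zero.\<close>

definition truncated_solution ::
    "nat \<Rightarrow> (nat \<Rightarrow> nat \<Rightarrow> complex) \<Rightarrow> nat \<Rightarrow> nat \<Rightarrow> nat \<Rightarrow> complex" where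
  "truncated_solution M v K m n = - (\<Sum>r<M. (- 1) ^ r * weighted_tail r K n (v (m + r)))"

text \<open>Splitting off \<open>r = 0\<close> and applying the Pascal recurrence to the other terms
  produces the sum for coordinate \<open>Suc m\<close>, short of its last term. That term involves
  \<open>v (m + M)\<close>, which vanishes. The condition \<open>n < K\<close> says that the forcing
  at time \<open>n\<close> has not yet been cut off.\<close>

lemma truncated_solution_Suc:
  assumes v0: "\<And>m. M < m \<Longrightarrow> v m = (\<lambda>_. 0)"
    and "1 \<le> m" "1 \<le> M" "n < K"
  shows "truncated_solution M v K m (Suc n) =
    truncated_solution M v K m n + truncated_solution M v K (Suc m) n + v m n"
proof -
  obtain M' where M': "M = Suc M'" using \<open>1 \<le> M\<close> by (cases M) auto
  define T where "T r a n = weighted_tail r K n (v a)" for r a n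
  have T_0: "T 0 a n = v a n + T 0 a (Suc n)" for a
    unfolding T_def by (rule weighted_tail_0[OF \<open>n < K\<close>])
  have T_Suc: "T (Suc r) a n = T r a n + T (Suc r) a (Suc n)" for r a
    unfolding T_def by (rule weighted_tail_Suc[OF \<open>n < K\<close>])
  have last: "T M' (Suc m + M') n = 0"
    using v0[of "Suc m + M'"] \<open>1 \<le> m\<close> by (simp add: T_def weighted_tail_def M')
  have "(\<Sum>r<M. (- 1) ^ r * T r (m + r) n)
      = T 0 m n - (\<Sum>r<M'. (- 1) ^ r * T (Suc r) (Suc (m + r)) n)"
    by (simp add: M' sum.lessThan_Suc_shift sum_negf del: sum.lessThan_Suc)
  also have "\<dots> = v m n + (T 0 m (Suc n) - (\<Sum>r<M'. (- 1) ^ r * T (Suc r) (Suc (m + r)) (Suc n)))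
      - (\<Sum>r<M'. (- 1) ^ r * T r (Suc (m + r)) n)"
    by (simp add: T_0[of m] T_Suc ring_distribs sum.distrib)
  also have "T 0 m (Suc n) - (\<Sum>r<M'. (- 1) ^ r * T (Suc r) (Suc (m + r)) (Suc n))
      = (\<Sum>r<M. (- 1) ^ r * T r (m + r) (Suc n))"
    by (simp add: M' sum.lessThan_Suc_shift sum_negf del: sum.lessThan_Suc)
  also have "(\<Sum>r<M'. (- 1) ^ r * T r (Suc (m + r)) n) = (\<Sum>r<M. (- 1) ^ r * T r (Suc m + r) n)"
    using last by (simp add: M')
  finally show ?thesis
    by (simp add: truncated_solution_def T_def)
qed

lemma bounded_solution_exists:
  fixes v w :: "nat \<Rightarrow> nat \<Rightarrow> complex"
  assumes "1 \<le> M"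
    and v0: "\<And>m. M < m \<Longrightarrow> v m = (\<lambda>_. 0)"
    and v: "\<And>m j. \<lbrakk>1 \<le> m; m \<le> M; 1 \<le> j\<rbrakk> \<Longrightarrow> v m j = w m j / of_nat j ^ (m - 1)"
    and w: "\<And>m. \<lbrakk>1 \<le> m; m \<le> M\<rbrakk> \<Longrightarrow> \<exists>B. \<forall>p q. 1 \<le> p \<longrightarrow> norm (sum (w m) {p..<q}) \<le> B"
  obtains S where
    "\<And>m. 2 \<le> m \<Longrightarrow> (\<lambda>K. truncated_solution M v K m 1) \<longlonglongrightarrow> S m 1"
    "\<And>m. M < m \<Longrightarrow> S m = (\<lambda>_. 0)"
    "\<And>m n. \<lbrakk>1 \<le> m; 1 \<le> n\<rbrakk> \<Longrightarrow> S m (Suc n) = S m n + S (Suc m) n + v m n"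
    "\<And>m. 1 \<le> m \<Longrightarrow> \<exists>C. \<forall>n\<ge>1. norm (S m n) \<le> C"
    "\<And>m r. 2 \<le> m \<Longrightarrow> summable (\<lambda>k. of_nat ((k + r) choose r) * v (m + r) (k + 1))"
proof -
  \<comment> \<open>The forcing \<open>v (m + r)\<close> carries the power \<open>m + r - 1\<close>
    in its denominator. For \<open>m \<ge> 1\<close> this is at least \<open>r\<close>, which
    suffices for a uniform bound.\<close>
  have tail_bound: "\<exists>C. \<forall>n\<ge>1. \<forall>K. norm (weighted_tail r K n (v (m + r))) \<le> C"
    if "1 \<le> m" for m r
  proof (cases "m + r \<le> M")
    case False
    then have "v (m + r) = (\<lambda>_. 0)" by (intro v0) auto
    then show ?thesis by (auto simp: weighted_tail_def)
  next
    case True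
    then obtain B where B: "\<And>p q. 1 \<le> p \<Longrightarrow> norm (sum (w (m + r)) {p..<q}) \<le> B"
      using w[of "m + r"] \<open>1 \<le> m\<close> by auto
    have "norm (weighted_tail r K n (v (m + r))) \<le> 2 ^ (m + r - 1) * B" if "1 \<le> n" for n K
    proof -
      have "weighted_tail r K n (v (m + r)) =
          (\<Sum>j\<in>{n..<K}. (real ((j - n + r) choose r) / real j ^ (m + r - 1)) *\<^sub>R w (m + r) j)"
        unfolding weighted_tail_def using that \<open>1 \<le> m\<close> True
        by (intro sum.cong) (auto simp: v scaleR_conv_of_real)
      then show ?thesis
        using norm_binomial_weighted_sum_le'[OF B that order_refl, of r "m + r - 1"] \<open>1 \<le> m\<close> by simp
    qed
    then show ?thesis by blast
  qed
  \<comment> \<open>For \<open>m \<ge> 2\<close> the power \<open>m + r - 1\<close> exceeds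
    \<open>r\<close> strictly, which gives convergence.\<close>
  have tail_summable: "summable (\<lambda>j. of_nat ((j - n + r) choose r) * v (m + r) j)"
    if "2 \<le> m" "1 \<le> n" for m n r
  proof (cases "m + r \<le> M")
    case False
    then have "v (m + r) = (\<lambda>_. 0)" by (intro v0) auto
    then show ?thesis by simp
  next
    case True
    then obtain B where B: "\<And>p q. 1 \<le> p \<Longrightarrow> norm (sum (w (m + r)) {p..<q}) \<le> B"
      using w[of "m + r"] \<open>2 \<le> m\<close> by auto
    have "summable (\<lambda>j. (real ((j - n + r) choose r) / real j ^ (m + r - 1)) *\<^sub>R w (m + r) j)"
      using \<open>2 \<le> m\<close> by (intro summable_binomial_weighted[OF B \<open>1 \<le> n\<close>]) auto
    \<comment> \<open>The relation between \<open>v\<close> and \<open>w\<close> is only available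
      for \<open>j \<ge> 1\<close>, hence an eventual equality.\<close>
    moreover have "\<forall>\<^sub>F j in sequentially. (real ((j - n + r) choose r) / real j ^ (m + r - 1)) *\<^sub>R w (m + r) j
        = of_nat ((j - n + r) choose r) * v (m + r) j"
      using eventually_ge_at_top[of 1]
      by eventually_elim (use \<open>2 \<le> m\<close> True in \<open>auto simp: v scaleR_conv_of_real\<close>)
    ultimately show ?thesis by (simp add: summable_cong)
  qed
  have tail_lim: "convergent (\<lambda>K. weighted_tail r K n (v (m + r)))" if "2 \<le> m" "1 \<le> n" for m n r
  proof -
    let ?f = "\<lambda>j. of_nat ((j - n + r) choose r) * v (m + r) j"
    \<comment> \<open>For \<open>j < n\<close> the truncated subtraction yields spurious terms of
      weight 1. There are finitely many, and subtracting the initial segment removes them.\<close>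
    have "(\<lambda>K. sum ?f {..<K} - sum ?f {..<n}) \<longlonglongrightarrow> suminf ?f - sum ?f {..<n}"
      by (intro tendsto_intros summable_LIMSEQ tail_summable that)
    moreover have "\<forall>\<^sub>F K in sequentially. sum ?f {..<K} - sum ?f {..<n} = weighted_tail r K n (v (m + r))"
      using eventually_ge_at_top[of n]
    proof eventually_elim
      case (elim K)
      then show ?case
        using sum_diff_nat_ivl[of 0 n K ?f] by (simp add: weighted_tail_def atLeast0LessThan)
    qed
    ultimately have "(\<lambda>K. weighted_tail r K n (v (m + r))) \<longlonglongrightarrow> suminf ?f - sum ?f {..<n}"
      by (rule Lim_transform_eventually)
    then show ?thesis by (rule convergentI)
  qed
  define R where "R K m n = truncated_solution M v K m n" for K m n
  have R_bound: "\<exists>C. \<forall>n\<ge>1. \<forall>K. norm (R K m n) \<le> C" if "1 \<le> m" for m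
  proof -
    obtain C where C: "\<And>r n K. 1 \<le> n \<Longrightarrow> norm (weighted_tail r K n (v (m + r))) \<le> C r"
      using tail_bound[OF \<open>1 \<le> m\<close>] by metis
    have "norm (R K m n) \<le> (\<Sum>r<M. C r)" if "1 \<le> n" for n K
      unfolding R_def truncated_solution_def norm_minus_cancel
      using C[OF that] by (intro sum_norm_le) (simp add: norm_mult norm_power)
    then show ?thesis by blast
  qed
  have R_lim: "convergent (\<lambda>K. R K m n)" if "2 \<le> m" "1 \<le> n" for m n
  proof -
    obtain L where L: "\<And>r. (\<lambda>K. weighted_tail r K n (v (m + r))) \<longlonglongrightarrow> L r"
      using tail_lim[OF \<open>2 \<le> m\<close> \<open>1 \<le> n\<close>] unfolding convergent_def by metis
    have "(\<lambda>K. R K m n) \<longlonglongrightarrow> - (\<Sum>r<M. (- 1) ^ r * L r)"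
      unfolding R_def truncated_solution_def by (intro tendsto_intros L)
    then show ?thesis by (rule convergentI)
  qed
  have R_Suc: "R K m (Suc n) = R K m n + R K (Suc m) n + v m n" if "1 \<le> m" "n < K" for K m n
    unfolding R_def using v0 that \<open>1 \<le> M\<close> by (intro truncated_solution_Suc)
  define S0 where "S0 m n = lim (\<lambda>K. R K m n)" for m n
  have S0_lim: "(\<lambda>K. R K m n) \<longlonglongrightarrow> S0 m n" if "2 \<le> m" "1 \<le> n" for m n
    using R_lim[OF that] by (simp add: S0_def convergent_LIMSEQ_iff)
  have R_0: "R K m n = 0" if "M < m" for K m n
    using that v0 by (simp add: R_def truncated_solution_def weighted_tail_def)
  \<comment> \<open>The truncated first coordinates need not converge, so the first coordinate is obtained by
    integrating the recurrence instead.\<close>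
  define S where "S m n = (if m = 1 then \<Sum>i\<in>{1..<n}. S0 2 i + v 1 i else S0 m n)" for m n
  show ?thesis
  proof
    show "(\<lambda>K. truncated_solution M v K m 1) \<longlonglongrightarrow> S m 1" if "2 \<le> m" for m
      using S0_lim[OF that, of 1] that by (simp add: S_def R_def)
    show "S m = (\<lambda>_. 0)" if "M < m" for m
      using that \<open>1 \<le> M\<close> R_0 by (auto simp: S_def S0_def)
    show "S m (Suc n) = S m n + S (Suc m) n + v m n" if "1 \<le> m" "1 \<le> n" for m n
    proof (cases "m = 1")
      case True
      then show ?thesis using that by (simp add: S_def numeral_2_eq_2)
    next
      case False
      then have "2 \<le> m" using that by simp
      have "(\<lambda>K. R K m n + R K (Suc m) n + v m n) \<longlonglongrightarrow> S0 m n + S0 (Suc m) n + v m n"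
        using \<open>2 \<le> m\<close> \<open>1 \<le> n\<close> by (intro tendsto_intros S0_lim) auto
      moreover have "\<forall>\<^sub>F K in sequentially. R K m n + R K (Suc m) n + v m n = R K m (Suc n)"
        using eventually_gt_at_top[of n] by eventually_elim (rule R_Suc [OF \<open>1 \<le> m\<close>, symmetric])
      ultimately have "(\<lambda>K. R K m (Suc n)) \<longlonglongrightarrow> S0 m n + S0 (Suc m) n + v m n"
        by (rule Lim_transform_eventually)
      moreover have "(\<lambda>K. R K m (Suc n)) \<longlonglongrightarrow> S0 m (Suc n)"
        using \<open>2 \<le> m\<close> by (intro S0_lim) auto
      ultimately show ?thesis
        using False that by (simp add: S_def LIMSEQ_unique)
    qed
    show "\<exists>C. \<forall>n\<ge>1. norm (S m n) \<le> C" if "1 \<le> m" for m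
    proof -
      obtain C where C: "\<And>n K. 1 \<le> n \<Longrightarrow> norm (R K m n) \<le> C" using R_bound[OF \<open>1 \<le> m\<close>] by auto
      show ?thesis
      proof (cases "m = 1")
        case False
        then have "2 \<le> m" using that by simp
        have "norm (S m n) \<le> C" if "1 \<le> n" for n
          using Lim_bounded[OF tendsto_norm[OF S0_lim[OF \<open>2 \<le> m\<close> that]]] C[OF that] False
          by (auto simp: S_def)
        then show ?thesis by blast
      next
        case True
        \<comment> \<open>By the recurrence the approximating sum telescopes to
          \<open>R K 1 n - R K 1 1\<close> as soon as \<open>n \<le> K\<close>. Each of the two
          terms is bounded by \<open>C\<close> independently of \<open>K\<close>, so the bound
          passes to the limit.\<close>
        have "norm (S 1 n) \<le> 2 * C" if "1 \<le> n" for n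
        proof -
          have "(\<lambda>K. \<Sum>i\<in>{1..<n}. R K 2 i + v 1 i) \<longlonglongrightarrow> (\<Sum>i\<in>{1..<n}. S0 2 i + v 1 i)"
            by (intro tendsto_intros S0_lim) auto
          then have "(\<lambda>K. \<Sum>i\<in>{1..<n}. R K 2 i + v 1 i) \<longlonglongrightarrow> S 1 n" by (simp add: S_def)
          then have lim: "(\<lambda>K. norm (\<Sum>i\<in>{1..<n}. R K 2 i + v 1 i)) \<longlonglongrightarrow> norm (S 1 n)"
            by (rule tendsto_norm)
          have "norm (\<Sum>i\<in>{1..<n}. R K 2 i + v 1 i) \<le> 2 * C" if "n \<le> K" for K
          proof -
            have "(\<Sum>i\<in>{1..<n}. R K 2 i + v 1 i) = (\<Sum>i\<in>{1..<n}. R K 1 (Suc i) - R K 1 i)"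
              using that by (intro sum.cong) (auto simp: R_Suc numeral_2_eq_2)
            also have "\<dots> = R K 1 n - R K 1 1"
              using \<open>1 \<le> n\<close> by (rule sum_Suc_diff')
            also have "norm \<dots> \<le> norm (R K 1 n) + norm (R K 1 1)" by (rule norm_triangle_ineq4)
            also have "\<dots> \<le> 2 * C" using C[OF \<open>1 \<le> n\<close>, of K] C[of 1 K] True by simp
            finally show ?thesis .
          qed
          then show ?thesis by (intro Lim_bounded[OF lim]) auto
        qed
        then show ?thesis using True by blast
      qed
    qed
    show "summable (\<lambda>k. of_nat ((k + r) choose r) * v (m + r) (k + 1))" if "2 \<le> m" for m r
    proof -
      have "summable (\<lambda>k. of_nat ((Suc k - 1 + r) choose r) * v (m + r) (Suc k))"
        using iffD2[OF summable_Suc_iff tail_summable[OF that order_refl, of r]] by simp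
      then show ?thesis by simp
    qed
  qed
qed

section \<open>Bounded solutions of the homogeneous system\<close>

lemma bounded_linear_growth_zero:
  fixes a c :: "'a::real_normed_vector"
  assumes "\<And>n. norm (a + of_nat n *\<^sub>R c) \<le> C"
  shows "c = 0"
proof (rule ccontr)
  assume "c \<noteq> 0"
  obtain n where n: "(C + norm a) / norm c < real n" using reals_Archimedean2 by blast
  have "real n * norm c = norm ((a + of_nat n *\<^sub>R c) - a)" by simp
  also have "\<dots> \<le> norm (a + of_nat n *\<^sub>R c) + norm a" by (rule norm_triangle_ineq4)
  also have "\<dots> \<le> C + norm a" using assms[of n] by simp
  finally show False using n \<open>c \<noteq> 0\<close> by (simp add: pos_divide_less_eq)
qed

text \<open>Descending induction on \<open>m\<close> from \<open>Suc M\<close>. If coordinate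
  \<open>Suc m\<close> vanishes, coordinate \<open>m\<close> is constant in time, so coordinate
  \<open>m - 1\<close> grows linearly with that constant as slope, and boundedness forces the slope
  to be 0. The argument ends at \<open>m = 2\<close>, since it looks one coordinate below
  \<open>m\<close>.\<close>

lemma bounded_homogeneous_solution_zero:
  fixes D :: "nat \<Rightarrow> nat \<Rightarrow> 'a::real_normed_vector"
  assumes D0: "\<And>m n. M < m \<Longrightarrow> D m n = 0"
    and rec: "\<And>m n. \<lbrakk>1 \<le> m; 1 \<le> n\<rbrakk> \<Longrightarrow> D m (Suc n) = D m n + D (Suc m) n"
    and bnd: "\<And>m. \<lbrakk>1 \<le> m; m \<le> M\<rbrakk> \<Longrightarrow> \<exists>C. \<forall>n\<ge>1. norm (D m n) \<le> C"
    and "2 \<le> m" "1 \<le> n"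
  shows "D m n = 0"
proof (cases "m \<le> M")
  case False
  then show ?thesis by (simp add: D0)
next
  case True
  then have "m \<le> Suc M" by simp
  then have "\<forall>n\<ge>1. D m n = 0" using \<open>2 \<le> m\<close>
  proof (induction m rule: inc_induct)
    case base
    then show ?case by (simp add: D0)
  next
    case (step m)
    obtain l where l: "m = Suc l" "1 \<le> l" using step.prems by (cases m) auto
    have const: "D m (Suc n) = D m 1" for n
    proof (induction n)
      case (Suc n)
      then show ?case using rec[of m "Suc n"] step.IH step.prems by simp
    qed simp
    have lin: "D l (Suc n) = D l 1 + of_nat n *\<^sub>R D m 1" for n
    proof (induction n)
      case (Suc n)
      then show ?case using rec[of l "Suc n"] l const[of n] by (simp add: algebra_simps)
    qed simp
    obtain C where C: "\<And>n. 1 \<le> n \<Longrightarrow> norm (D l n) \<le> C"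
      using bnd[of l] l step.hyps by auto
    have "D m 1 = 0"
      by (rule bounded_linear_growth_zero[of "D l 1" _ C]) (simp only: lin[symmetric] C)
    then show ?case using const by (metis Suc_le_D One_nat_def)
  qed
  then show ?thesis using \<open>1 \<le> n\<close> by simp
qed

text \<open>The difference of \<open>u\<close> and the bounded solution \<open>S\<close> solves the
  homogeneous system. Coordinate 1 is left unconstrained because a constant difference there keeps
  \<open>u\<close> bounded.\<close>

lemma bounded_iff_initial_values:
  fixes u v S :: "nat \<Rightarrow> nat \<Rightarrow> 'a::real_normed_vector"
  assumes u0: "\<And>m n. M < m \<Longrightarrow> u m n = 0"
    and u_Suc: "\<And>m n. \<lbrakk>1 \<le> m; 1 \<le> n\<rbrakk> \<Longrightarrow> u m (Suc n) = u m n + u (Suc m) n + v m n"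
    and S0: "\<And>m n. M < m \<Longrightarrow> S m n = 0"
    and S_Suc: "\<And>m n. \<lbrakk>1 \<le> m; 1 \<le> n\<rbrakk> \<Longrightarrow> S m (Suc n) = S m n + S (Suc m) n + v m n"
    and S_bound: "\<And>m. 1 \<le> m \<Longrightarrow> \<exists>C. \<forall>n\<ge>1. norm (S m n) \<le> C"
  shows "(\<forall>m\<in>{1..M}. \<exists>C. \<forall>n\<ge>1. norm (u m n) \<le> C) \<longleftrightarrow> (\<forall>m\<in>{2..M}. u m 1 = S m 1)"
proof
  define D where "D m n = u m n - S m n" for m n
  have D0: "D m n = 0" if "M < m" for m n
    using that by (simp add: D_def u0 S0)
  have D_Suc: "D m (Suc n) = D m n + D (Suc m) n" if "1 \<le> m" "1 \<le> n" for m n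
    using that by (simp add: D_def u_Suc S_Suc)
  {
    assume u: "\<forall>m\<in>{1..M}. \<exists>C. \<forall>n\<ge>1. norm (u m n) \<le> C"
    have bnd: "\<exists>C. \<forall>n\<ge>1. norm (D m n) \<le> C" if "1 \<le> m" "m \<le> M" for m
    proof -
      obtain C where "\<forall>n\<ge>1. norm (u m n) \<le> C"
        using u \<open>1 \<le> m\<close> \<open>m \<le> M\<close> by (meson atLeastAtMost_iff)
      moreover obtain C' where "\<forall>n\<ge>1. norm (S m n) \<le> C'"
        using S_bound[OF \<open>1 \<le> m\<close>] by blast
      ultimately have "\<forall>n\<ge>1. norm (D m n) \<le> C + C'"
        unfolding D_def by (meson add_mono norm_triangle_ineq4 order_trans)
      then show ?thesis by blast
    qed
    show "\<forall>m\<in>{2..M}. u m 1 = S m 1"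
    proof
      fix m assume "m \<in> {2..M}"
      then have "D m 1 = 0"
        by (intro bounded_homogeneous_solution_zero[where D = D and M = M, OF D0 D_Suc bnd]) auto
      then show "u m 1 = S m 1" by (simp add: D_def)
    qed
  }
  {
    assume init: "\<forall>m\<in>{2..M}. u m 1 = S m 1"
    \<comment> \<open>The induction over time treats all \<open>m \<ge> 2\<close> at once, as the
      step for \<open>m\<close> uses coordinate \<open>Suc m\<close>.\<close>
    have D_2: "D m (Suc n) = 0" if "2 \<le> m" for m n
      using that
    proof (induction n arbitrary: m)
      case 0
      then show ?case using init D0[of m 1] by (cases "m \<le> M") (auto simp: D_def)
    next
      case (Suc n)
      then show ?case using D_Suc[of m "Suc n"] by simp
    qed
    have D_1: "D 1 (Suc n) = D 1 1" for n
    proof (induction n)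
      case (Suc n)
      then show ?case using D_Suc[of 1 "Suc n"] D_2[of 2 n] by (simp add: numeral_2_eq_2)
    qed simp
    have "norm (u m n) \<le> C + norm (D 1 1)"
      if "1 \<le> m" "1 \<le> n" "\<forall>n\<ge>1. norm (S m n) \<le> C" for m n C
    proof -
      obtain n' where "n = Suc n'" using \<open>1 \<le> n\<close> by (cases n) auto
      then have "D m n = 0 \<or> D m n = D 1 1"
        using D_1[of n'] D_2[of m n'] \<open>1 \<le> m\<close> by (cases "m = 1") auto
      then have "norm (D m n) \<le> norm (D 1 1)" by auto
      moreover have "u m n = S m n + D m n" by (simp add: D_def)
      moreover have "norm (S m n) \<le> C" using that by blast
      ultimately show ?thesis by (metis add_mono norm_triangle_le)
    qed
    then show "\<forall>m\<in>{1..M}. \<exists>C. \<forall>n\<ge>1. norm (u m n) \<le> C"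
      using S_bound by (meson atLeastAtMost_iff)
  }
qed

section \<open>From vectors and the scalar equation to coordinates and block sums\<close>

lemma jordan_block_mult_vec_index:
  fixes a :: "'a::comm_semiring_1"
  assumes "z \<in> carrier_vec M" "i < M"
  shows "(jordan_block M a *\<^sub>v z) $ i = a * z $ i + (if Suc i < M then z $ Suc i else 0)"
proof -
  have "(jordan_block M a *\<^sub>v z) $ i = (\<Sum>j\<in>{0..<M}. (if i = j then a else if Suc i = j then 1 else 0) * z $ j)"
    using assms by (simp add: jordan_block_def scalar_prod_def)
  also have "\<dots> = (\<Sum>j\<in>{0..<M}. (if i = j then a * z $ j else 0) + (if Suc i = j then z $ j else 0))"
    by (intro sum.cong) auto
  finally show ?thesis using assms by (simp add: sum.distrib)
qed

text \<open>The Euclidean norm lies between the modulus of any coordinate and the sum of all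
  moduli.\<close>

lemma bounded_vec_seq_iff:
  assumes "\<And>n. 1 \<le> n \<Longrightarrow> x n \<in> carrier_vec M"
  shows "bounded_vec_seq x \<longleftrightarrow> (\<forall>i\<in>{..<M}. \<exists>C. \<forall>n\<ge>1. cmod (x n $ i) \<le> C)"
proof
  assume "bounded_vec_seq x"
  then obtain C where C: "\<And>n. 1 \<le> n \<Longrightarrow> euclidean_norm_vec (x n) \<le> C"
    by (auto simp: bounded_vec_seq_def)
  have "cmod (x n $ i) \<le> C" if "i < M" "1 \<le> n" for i n
  proof -
    have "cmod (x n $ i) \<le> euclidean_norm_vec (x n)"
      unfolding euclidean_norm_vec_def using that assms[OF \<open>1 \<le> n\<close>]
      by (intro member_le_L2_set) auto
    then show ?thesis using C[OF \<open>1 \<le> n\<close>] by linarith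
  qed
  then show "\<forall>i\<in>{..<M}. \<exists>C. \<forall>n\<ge>1. cmod (x n $ i) \<le> C" by blast
next
  assume "\<forall>i\<in>{..<M}. \<exists>C. \<forall>n\<ge>1. cmod (x n $ i) \<le> C"
  then obtain C where C: "\<And>i n. \<lbrakk>i < M; 1 \<le> n\<rbrakk> \<Longrightarrow> cmod (x n $ i) \<le> C i"
    by (metis lessThan_iff)
  have "euclidean_norm_vec (x n) \<le> (\<Sum>i<M. C i)" if "1 \<le> n" for n
  proof -
    have "euclidean_norm_vec (x n) \<le> (\<Sum>i<M. cmod (x n $ i))"
      unfolding euclidean_norm_vec_def using assms[OF that] by (simp add: L2_set_le_sum)
    also have "\<dots> \<le> (\<Sum>i<M. C i)" using C that by (intro sum_mono) auto
    finally show ?thesis .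
  qed
  then show "bounded_vec_seq x" by (auto simp: bounded_vec_seq_def)
qed

text \<open>Multiplying the solution by \<open>inverse lam ^ (m + n)\<close> makes the block sums
  telescope, and \<open>cmod lam = 1\<close> preserves its bound. The shift by \<open>m\<close>
  contributes only a unimodular constant and matches the rescaling of the \<open>m\<close>-th
  coordinate of the system.\<close>

lemma has_bounded_scalar_solution_partial_sums:
  assumes "has_bounded_scalar_solution lam w" and lam: "cmod lam = 1"
  shows "\<exists>B. \<forall>p q. 1 \<le> p \<longrightarrow> norm (\<Sum>j\<in>{p..<q}. inverse lam ^ (m + j + 1) * w j) \<le> B"
proof -
  obtain z C where z: "\<And>n. 1 \<le> n \<Longrightarrow> z (n + 1) = lam * z n + w n"
    and C: "\<And>n. 1 \<le> n \<Longrightarrow> cmod (z n) \<le> C"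
    using assms(1) unfolding has_bounded_scalar_solution_def by blast
  have lam0: "lam \<noteq> 0" using lam by auto
  define g where "g n = inverse lam ^ (m + n) * z n" for n
  have g_norm: "cmod (g n) \<le> C" if "1 \<le> n" for n
    using C[OF that] lam by (simp add: g_def norm_mult norm_power norm_inverse)
  have g_Suc: "inverse lam ^ (m + j + 1) * w j = g (Suc j) - g j" if "1 \<le> j" for j
    using z[OF that] lam0 by (simp add: g_def field_simps)
  have "0 \<le> C" using C[of 1] norm_ge_zero[of "z 1"] by linarith
  have "norm (\<Sum>j\<in>{p..<q}. inverse lam ^ (m + j + 1) * w j) \<le> 2 * C" if "1 \<le> p" for p q
  proof (cases "p \<le> q")
    case True
    have "(\<Sum>j\<in>{p..<q}. inverse lam ^ (m + j + 1) * w j) = (\<Sum>j\<in>{p..<q}. g (Suc j) - g j)"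
      using that by (intro sum.cong g_Suc) auto
    also have "\<dots> = g q - g p" using True by (rule sum_Suc_diff')
    also have "norm \<dots> \<le> norm (g q) + norm (g p)" by (rule norm_triangle_ineq4)
    also have "\<dots> \<le> 2 * C" using g_norm[of p] g_norm[of q] that True by simp
    finally show ?thesis .
  next
    case False
    then show ?thesis using \<open>0 \<le> C\<close> by simp
  qed
  then show ?thesis by blast
qed

section \<open>Rescaling the Jordan system and identifying the initial values\<close>

text \<open>The summability conjunct guarantees that the infinite sums in the criterion are genuine
  limits of partial sums. Series indices are shifted by 1 since they begin at \<open>k = 1\<close>,
  and coordinates by 1 since vector entries are numbered from 0.\<close>

theorem theorem3p6:
  fixes M :: nat and lam :: complex
    and yt y :: "nat \<Rightarrow> nat \<Rightarrow> complex"
    and x :: "nat \<Rightarrow> complex vec"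
  assumes M: "M \<ge> 2"
    and lam: "cmod lam = 1"
    and y: "\<And>m n. \<lbrakk>1 \<le> m; m \<le> M; n \<ge> 1\<rbrakk> \<Longrightarrow> y m n = yt m n / of_nat n ^ (m - 1)"
    and yt: "\<And>m. \<lbrakk>1 \<le> m; m \<le> M\<rbrakk> \<Longrightarrow> has_bounded_scalar_solution lam (yt m)"
    and x_init: "x 1 \<in> carrier_vec M"
    and x_step: "\<And>n. n \<ge> 1 \<Longrightarrow>
      x (n + 1) = jordan_block M lam *\<^sub>v x n + vec M (\<lambda>i. y (i + 1) n)"
  shows "(\<forall>m\<in>{2..M}. \<forall>r\<in>{0..M - m}. summable (\<lambda>k. init_series_term lam y m r (k + 1))) \<and>
    (bounded_vec_seq x \<longleftrightarrow>
      (\<forall>m\<in>{2..M}. x 1 $ (m - 1) =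
        - (\<Sum>r=0..M - m. (- 1) ^ r * (\<Sum>k. init_series_term lam y m r (k + 1)))))"
proof -
  have lam0: "lam \<noteq> 0" using lam by auto
  define \<mu> where "\<mu> = inverse lam"
  have \<mu>: "\<mu> \<noteq> 0" "lam * \<mu> = 1" "cmod \<mu> = 1"
    using lam lam0 by (auto simp: \<mu>_def norm_inverse)
  \<comment> \<open>The power of \<open>\<mu>\<close> in \<open>n\<close> normalises the diagonal to
    1, and the power in \<open>m\<close> does the same for the superdiagonal. Extension by 0 above
    \<open>M\<close> lets the last row obey the same recurrence as the others.\<close>
  define u where "u m n = (if 1 \<le> m \<and> m \<le> M then \<mu> ^ (m + n) * x n $ (m - 1) else 0)" for m n
  define v where "v m n = (if 1 \<le> m \<and> m \<le> M then \<mu> ^ (m + n + 1) * y m n else 0)" for m n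
  define w where "w m n = \<mu> ^ (m + n + 1) * yt m n" for m n
  have x_carrier: "x n \<in> carrier_vec M" if n: "1 \<le> n" for n
  proof (cases "n = 1")
    case False
    then obtain k where k: "n = k + 1" "1 \<le> k"
      using n by (metis One_nat_def Suc_eq_plus1 Suc_leI Suc_le_D not_gr_zero)
    show ?thesis
      unfolding k(1) x_step[OF k(2)] by (rule carrier_vecI) simp
  qed (simp only: x_init)
  have u_Suc: "u m (Suc n) = u m n + u (Suc m) n + v m n" if "1 \<le> m" "1 \<le> n" for m n
  proof (cases "m \<le> M")
    case True
    define i where "i = m - 1"
    have i: "m = Suc i" "i < M" using \<open>1 \<le> m\<close> True by (auto simp: i_def)
    have "x (Suc n) $ i = (jordan_block M lam *\<^sub>v x n) $ i + y m n"
      using x_step[OF \<open>1 \<le> n\<close>] i by simp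
    also have "(jordan_block M lam *\<^sub>v x n) $ i = lam * x n $ i + (if Suc i < M then x n $ Suc i else 0)"
      by (rule jordan_block_mult_vec_index[OF x_carrier[OF \<open>1 \<le> n\<close>] i(2)])
    finally have "u m (Suc n) = \<mu> ^ (m + n + 1) *
        (lam * x n $ i + (if Suc i < M then x n $ Suc i else 0) + y m n)"
      using i by (simp add: u_def)
    also have "\<dots> = (lam * \<mu>) * (\<mu> ^ (m + n) * x n $ i)
        + \<mu> ^ (m + n + 1) * (if Suc i < M then x n $ Suc i else 0) + \<mu> ^ (m + n + 1) * y m n"
      by (simp add: ring_distribs)
    also have "\<dots> = u m n + u (Suc m) n + v m n"
      unfolding \<mu>(2) using i by (simp add: u_def v_def)
    finally show ?thesis .
  qed (simp add: u_def v_def)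
  have v_0: "v m = (\<lambda>_. 0)" if "M < m" for m
    using that by (auto simp: v_def)
  have v_w: "v m j = w m j / of_nat j ^ (m - 1)" if "1 \<le> m" "m \<le> M" "1 \<le> j" for m j
    using that by (simp add: v_def w_def y)
  have w_sums: "\<exists>B. \<forall>p q. 1 \<le> p \<longrightarrow> norm (sum (w m) {p..<q}) \<le> B" if "1 \<le> m" "m \<le> M" for m
    unfolding w_def \<mu>_def by (rule has_bounded_scalar_solution_partial_sums[OF yt[OF that] lam])
  have "1 \<le> M" using M by simp
  obtain S where S_lim: "\<And>m. 2 \<le> m \<Longrightarrow> (\<lambda>K. truncated_solution M v K m 1) \<longlonglongrightarrow> S m 1"
    and S_0: "\<And>m. M < m \<Longrightarrow> S m = (\<lambda>_. 0)"
    and S_Suc: "\<And>m n. \<lbrakk>1 \<le> m; 1 \<le> n\<rbrakk> \<Longrightarrow> S m (Suc n) = S m n + S (Suc m) n + v m n"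
    and S_bound: "\<And>m. 1 \<le> m \<Longrightarrow> \<exists>C. \<forall>n\<ge>1. norm (S m n) \<le> C"
    and summ: "\<And>m r. 2 \<le> m \<Longrightarrow> summable (\<lambda>k. of_nat ((k + r) choose r) * v (m + r) (k + 1))"
  proof (rule bounded_solution_exists[where M = M and v = v and w = w, OF \<open>1 \<le> M\<close>], goal_cases)
    case 1
    show ?case by (rule v_0[OF 1(2)])
  next
    case 2
    show ?case by (rule v_w[OF 2(2-)])
  next
    case 3
    show ?case by (rule w_sums[OF 3(2-)])
  next
    case (4 S)
    show ?case by (rule 4(1)[OF 4(2-)])
  qed
  \<comment> \<open>For \<open>j = k + 1\<close> and \<open>n = 1\<close> the tail weight
    \<open>(j - n + r) choose r\<close> is exactly the coefficient of the series.\<close>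
  have binom: "pochhammer (of_nat (k + 1)) r / fact r = (of_nat ((k + r) choose r) :: complex)" for k r
    by (simp add: binomial_gbinomial gbinomial_pochhammer' add.commute)
  \<comment> \<open>The exponent \<open>(m + r) + (k + 1) + 1\<close> splits as
    \<open>(m + 1) + (k + 1 + r)\<close>. The factor \<open>\<mu> ^ (m + 1)\<close> is independent
    of \<open>r\<close> and \<open>k\<close>, and it is also the factor in \<open>u m 1\<close>, so
    it cancels at the end.\<close>
  have term_eq: "of_nat ((k + r) choose r) * v (m + r) (k + 1)
      = \<mu> ^ (m + 1) * init_series_term lam y m r (k + 1)"
    if "1 \<le> m" "m + r \<le> M" for m r k
  proof -
    have "lam powi (- int (k + 1) - int r) = lam powi (- int (k + 1 + r))"
      by (simp add: algebra_simps)
    also have "\<dots> = \<mu> ^ (k + 1 + r)"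
      unfolding power_int_minus power_int_of_nat by (simp add: \<mu>_def power_inverse)
    finally show ?thesis
      using that unfolding init_series_term_def binom
      by (simp add: v_def power_add add_ac mult_ac)
  qed
  have summable_init: "summable (\<lambda>k. init_series_term lam y m r (k + 1))"
    if "m \<in> {2..M}" "r \<in> {0..M - m}" for m r
  proof -
    have "summable (\<lambda>k. \<mu> ^ (m + 1) * init_series_term lam y m r (k + 1))"
    proof (rule summable_cong [THEN iffD1, OF always_eventually summ])
      show "\<forall>k. of_nat ((k + r) choose r) * v (m + r) (k + 1) = \<mu> ^ (m + 1) * init_series_term lam y m r (k + 1)"
        using that by (intro allI term_eq) auto
    qed (use that in auto)
    then show ?thesis using \<mu>(1) by (simp add: summable_cmult_iff)
  qed
  have S_eq: "S m 1 = \<mu> ^ (m + 1) * - (\<Sum>r=0..M - m. (- 1) ^ r * (\<Sum>k. init_series_term lam y m r (k + 1)))"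
    if m: "m \<in> {2..M}" for m
  proof -
    \<comment> \<open>With cut-off \<open>Suc K\<close> the times \<open>1, ..., K\<close>
      correspond to the first \<open>K\<close> terms of each series.\<close>
    have trunc: "truncated_solution M v (Suc K) m 1
        = \<mu> ^ (m + 1) * - (\<Sum>r=0..M - m. (- 1) ^ r * (\<Sum>k<K. init_series_term lam y m r (k + 1)))" for K
    proof -
      have tail: "weighted_tail r (Suc K) 1 (v (m + r)) =
          (\<Sum>k<K. of_nat ((k + r) choose r) * v (m + r) (k + 1))" for r
        unfolding weighted_tail_def One_nat_def sum.shift_bounds_Suc_ivl by (simp add: atLeast0LessThan)
      have "(\<Sum>r<M. (- 1) ^ r * weighted_tail r (Suc K) 1 (v (m + r))) =
          (\<Sum>r=0..M - m. (- 1) ^ r * weighted_tail r (Suc K) 1 (v (m + r)))"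
        using m by (intro sum.mono_neutral_right) (auto simp: weighted_tail_def v_def)
      also have "\<dots> = (\<Sum>r=0..M - m. \<mu> ^ (m + 1) * ((- 1) ^ r * (\<Sum>k<K. init_series_term lam y m r (k + 1))))"
      proof (rule sum.cong)
        fix r assume "r \<in> {0..M - m}"
        then have "weighted_tail r (Suc K) 1 (v (m + r)) = (\<Sum>k<K. \<mu> ^ (m + 1) * init_series_term lam y m r (k + 1))"
          unfolding tail using m by (intro sum.cong term_eq) auto
        then show "(- 1) ^ r * weighted_tail r (Suc K) 1 (v (m + r)) =
            \<mu> ^ (m + 1) * ((- 1) ^ r * (\<Sum>k<K. init_series_term lam y m r (k + 1)))"
          by (simp only: sum_distrib_left mult.left_commute)
      qed simp
      finally show ?thesis
        by (simp add: truncated_solution_def sum_distrib_left)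
    qed
    have "(\<lambda>K. truncated_solution M v (Suc K) m 1) \<longlonglongrightarrow>
        \<mu> ^ (m + 1) * - (\<Sum>r=0..M - m. (- 1) ^ r * (\<Sum>k. init_series_term lam y m r (k + 1)))"
      unfolding trunc by (intro tendsto_intros summable_LIMSEQ summable_init m)
    moreover have "(\<lambda>K. truncated_solution M v (Suc K) m 1) \<longlonglongrightarrow> S m 1"
      using S_lim[of m] m by (intro LIMSEQ_Suc) auto
    ultimately show ?thesis by (intro LIMSEQ_unique)
  qed
  have "bounded_vec_seq x \<longleftrightarrow> (\<forall>i\<in>{..<M}. \<exists>C. \<forall>n\<ge>1. cmod (x n $ i) \<le> C)"
    by (rule bounded_vec_seq_iff[OF x_carrier])
  also have "\<dots> \<longleftrightarrow> (\<forall>m\<in>{1..M}. \<exists>C. \<forall>n\<ge>1. cmod (x n $ (m - 1)) \<le> C)"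
    unfolding image_Suc_lessThan [symmetric] by simp
  also have "\<dots> \<longleftrightarrow> (\<forall>m\<in>{1..M}. \<exists>C. \<forall>n\<ge>1. norm (u m n) \<le> C)"
    by (intro ball_cong refl) (simp add: u_def norm_mult norm_power \<mu>(3))
  also have "\<dots> \<longleftrightarrow> (\<forall>m\<in>{2..M}. u m 1 = S m 1)"
  proof (rule bounded_iff_initial_values)
    show "u m n = 0" if "M < m" for m n
      using that by (simp add: u_def)
    show "S m n = 0" if "M < m" for m n
      using S_0[OF that] by simp
  qed (fact u_Suc S_Suc S_bound)+
  also have "\<dots> \<longleftrightarrow> (\<forall>m\<in>{2..M}. x 1 $ (m - 1) =
        - (\<Sum>r=0..M - m. (- 1) ^ r * (\<Sum>k. init_series_term lam y m r (k + 1))))"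
  proof (rule ball_cong)
    fix m assume m: "m \<in> {2..M}"
    then have "u m 1 = \<mu> ^ (m + 1) * x 1 $ (m - 1)" by (simp add: u_def)
    moreover have "\<mu> ^ (m + 1) \<noteq> 0" using \<mu>(1) by simp
    ultimately show "u m 1 = S m 1 \<longleftrightarrow> x 1 $ (m - 1) =
        - (\<Sum>r=0..M - m. (- 1) ^ r * (\<Sum>k. init_series_term lam y m r (k + 1)))"
      by (simp only: S_eq[OF m] mult_cancel_left simp_thms)
  qed simp
  finally have iff: "bounded_vec_seq x \<longleftrightarrow> (\<forall>m\<in>{2..M}. x 1 $ (m - 1) =
        - (\<Sum>r=0..M - m. (- 1) ^ r * (\<Sum>k. init_series_term lam y m r (k + 1))))" .
  show ?thesis by (intro conjI ballI summable_init iff)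
qed

end
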